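(* Let $(W^*,X^*,U^*,V^* )\in\mathcal{M}$ be an integer master problem solution, let $k\in N$ and $t\in T$, and assume that the sub-problem $\mathrm{SP}_{kt}(W^*,X^* )$ is feasible. For $i\in N$ let $\bar D_i\in[0,\infty]$ be the length of a shortest directed path, with arc lengths $\rho_{ijt}$, from $i$ to an open facility (a node $j$ with $W^*_{jt}=1$) in the network consisting of the open arcs $\{(i,j)\in A:X^*_{ijt}=1\}$ (so $\bar D_i=0$ if $W^*_{it}=1$, and $\bar D_i=\infty$ if there is no such path). For $i\in N$ let $D_i\in[0,\infty]$ be the length of a shortest directed path, with arc lengths $\rho_{ijt}$, from $k$ to $i$ in the network in which all arcs of $A$ are open (with $D_k=0$, and $D_i=\infty$ if there is no such path). Define $$\gamma_k=\bar D_k,\qquad \gamma_i=\max\bigl(0,\min(\gamma_k-D_i,\bar D_i)\bigr)\quad(i\in N\setminus\{k\}),$$ and, for $(i,j)\in A$, $$\lambda_{ij}=\begin{cases}\max(0,\gamma_i-\gamma_j-\rho_{ijt}) & \text{if } X^*_{ijt}=0,\\ 0 & \text{if } X^*_{ijt}=1.\end{cases}$$ Then $(\gamma,\lambda)$ is an optimal solution of the dual linear program $\mathrm{D}_{kt}(W^*,X^* )$.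
   Context: Setting (dynamic uncapacitated facility location and network design). $N$ is a finite set of nodes (each is a client and a potential facility site), $A\subseteq N\times N$ is a set of arcs such that $(j,i)\in A$ whenever $(i,j)\in A$, and $T=\{1,\dots,|T|\}$ is the set of time periods. Data, all nonnegative reals: $\rho_{ijt}$ (unit routing cost on arc $(i,j)$ at time $t$), $g_{it}$ (cost of opening facility $i$), $c_{ijt}$ (cost of constructing arc $(i,j)$), $\bar B_t,\hat B_t$ (budgets for facilities and arcs). The initial network is given by fixed binary values $W_{i0}$, $X_{ij0}$. Integer master solutions. $\mathcal{M}$ is the set of binary vectors $(W,X,U,V)$ (with $W_{it},U_{it}$ indexed by $i\in N,t\in T$ and $X_{ijt},V_{ijt}$ indexed by $(i,j)\in A,t\in T$) satisfying $W_{i,t-1}+U_{it}=W_{it}$ for all $i,t$; $X_{ij,t-1}+V_{ijt}=X_{ijt}$ for all $(i,j)\in A$, $t$; $\sum_{t'=1}^t\sum_{i\in N}g_{it'}U_{it'}\le\sum_{t'=1}^t\bar B_{t'}$ for all $t$; $\sum_{t'=1}^t\sum_{(i,j)\in A}c_{ijt'}V_{ijt'}\le\sum_{t'=1}^t\hat B_{t'}$ for all $t$; and $X_{ijt}=X_{jit}$ for all $(i,j)\in A$, $t$. Here $W_{it}=1$ means facility $i$ is open at time $t$, and $X_{ijt}=1$ means arc $(i,j)$ is open at time $t$. Sub-problem $\mathrm{SP}_{kt}(W^*,X^* )$: minimise $\sum_{(i,j)\in A}\rho_{ijt}Z_{ij}$ over $Z\in\mathbb{R}^A_{\ge0}$ subject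 to $-\sum_{j:(k,j)\in A}Z_{kj}\le W^*_{kt}-1$; $\sum_{j:(j,i)\in A}Z_{ji}-\sum_{j:(i,j)\in A}Z_{ij}\le W^*_{it}$ for all $i\in N\setminus\{k\}$; $Z_{jk}=0$ for all $(j,k)\in A$; $Z_{ij}\le X^*_{ijt}$ for all $(i,j)\in A$. Dual $\mathrm{D}_{kt}(W^*,X^* )$: maximise $\gamma_k-\sum_{i\in N}\gamma_iW^*_{it}-\sum_{(i,j)\in A}\lambda_{ij}X^*_{ijt}$ over $\gamma\in\mathbb{R}^N_{\ge0}$, $\lambda\in\mathbb{R}^A_{\ge0}$ subject to $\rho_{ijt}+\lambda_{ij}+\gamma_j-\gamma_i\ge0$ for all $(i,j)\in A$ with $j\ne k$. *)

theory Defs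
  imports Complex_Main "Graph_Theory.Shortest_Path"
begin

text \<open>
  An instance of the dynamic uncapacitated facility location and network design problem.
  The periods are \<open>{1..horizon P}\<close>; an arc \<open>(i, j)\<close> is a pair, so \<open>\<rho>\<^sub>i\<^sub>j\<^sub>t\<close>
  is written \<open>route_cost P (i, j) t\<close>.
\<close>

record 'a design_problem =
  nodes :: "'a set"
  links :: "('a \<times> 'a) set"
  horizon :: nat
  route_cost :: "'a \<times> 'a \<Rightarrow> nat \<Rightarrow> real"     \<comment> \<open>\<open>\<rho>\<close>\<close>
  open_cost :: "'a \<Rightarrow> nat \<Rightarrow> real"            \<comment> \<open>\<open>g\<close>\<close>
  build_cost :: "'a \<times> 'a \<Rightarrow> nat \<Rightarrow> real"     \<comment> \<open>\<open>c\<close>\<close>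
  facility_budget :: "nat \<Rightarrow> real"
  link_budget :: "nat \<Rightarrow> real"
  init_facility :: "'a \<Rightarrow> real"               \<comment> \<open>\<open>W\<close> at time 0\<close>
  init_link :: "'a \<times> 'a \<Rightarrow> real"             \<comment> \<open>\<open>X\<close> at time 0\<close>

definition periods :: "'a design_problem \<Rightarrow> nat set" where
  "periods P = {1..horizon P}"

definition valid_problem :: "'a design_problem \<Rightarrow> bool" where
  "valid_problem P \<longleftrightarrow>
     finite (nodes P) \<and>
     links P \<subseteq> nodes P \<times> nodes P \<and>
     sym (links P) \<and>
     (\<forall>a\<in>links P. \<forall>t\<in>periods P. 0 \<le> route_cost P a t) \<and>
     (\<forall>i\<in>nodes P. \<forall>t\<in>periods P. 0 \<le> open_cost P i t) \<and>
     (\<forall>a\<in>links P. \<forall>t\<in>periods P. 0 \<le> build_cost P a t) \<and>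
     (\<forall>t\<in>periods P. 0 \<le> facility_budget P t) \<and>
     (\<forall>t\<in>periods P. 0 \<le> link_budget P t) \<and>
     (\<forall>i\<in>nodes P. init_facility P i \<in> {0, 1}) \<and>
     (\<forall>a\<in>links P. init_link P a \<in> {0, 1})"

text \<open>
  The set of integer master solutions \<open>(W, X, U, V)\<close>.  The variables are indexed by the
  periods \<open>1, \<dots>, horizon P\<close>; in addition \<open>W i 0\<close> and \<open>X a 0\<close> hold the given initial network,
  so that the recursions can be written uniformly.  Values at other indices are irrelevant.
\<close>

definition master_solutions ::
  "'a design_problem \<Rightarrow>
     (('a \<Rightarrow> nat \<Rightarrow> real) \<times> ('a \<times> 'a \<Rightarrow> nat \<Rightarrow> real) \<times>
      ('a \<Rightarrow> nat \<Rightarrow> real) \<times> ('a \<times> 'a \<Rightarrow> nat \<Rightarrow> real)) set" where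
  "master_solutions P = {(W, X, U, V).
     (\<forall>i\<in>nodes P. \<forall>t\<in>periods P. W i t \<in> {0, 1} \<and> U i t \<in> {0, 1}) \<and>
     (\<forall>a\<in>links P. \<forall>t\<in>periods P. X a t \<in> {0, 1} \<and> V a t \<in> {0, 1}) \<and>
     (\<forall>i\<in>nodes P. W i 0 = init_facility P i) \<and>
     (\<forall>a\<in>links P. X a 0 = init_link P a) \<and>
     (\<forall>i\<in>nodes P. \<forall>t\<in>periods P. W i (t - 1) + U i t = W i t) \<and>
     (\<forall>a\<in>links P. \<forall>t\<in>periods P. X a (t - 1) + V a t = X a t) \<and>
     (\<forall>t\<in>periods P. (\<Sum>s=1..t. \<Sum>i\<in>nodes P. open_cost P i s * U i s)
                      \<le> (\<Sum>s=1..t. facility_budget P s)) \<and>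
     (\<forall>t\<in>periods P. (\<Sum>s=1..t. \<Sum>a\<in>links P. build_cost P a s * V a s)
                      \<le> (\<Sum>s=1..t. link_budget P s)) \<and>
     (\<forall>(i, j)\<in>links P. \<forall>t\<in>periods P. X (i, j) t = X (j, i) t)}"

text \<open>The constraints of the sub-problem \<open>SP\<^sub>k\<^sub>t(W, X)\<close> on a flow \<open>Z\<close>.\<close>

definition sp_feasible_point ::
  "'a design_problem \<Rightarrow> ('a \<Rightarrow> nat \<Rightarrow> real) \<Rightarrow> ('a \<times> 'a \<Rightarrow> nat \<Rightarrow> real) \<Rightarrow>
     'a \<Rightarrow> nat \<Rightarrow> ('a \<times> 'a \<Rightarrow> real) \<Rightarrow> bool" where
  "sp_feasible_point P W X k t Z \<longleftrightarrow>
     (\<forall>a\<in>links P. 0 \<le> Z a) \<and>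
     - (\<Sum>j | (k, j) \<in> links P. Z (k, j)) \<le> W k t - 1 \<and>
     (\<forall>i\<in>nodes P - {k}.
        (\<Sum>j | (j, i) \<in> links P. Z (j, i)) - (\<Sum>j | (i, j) \<in> links P. Z (i, j)) \<le> W i t) \<and>
     (\<forall>j. (j, k) \<in> links P \<longrightarrow> Z (j, k) = 0) \<and>
     (\<forall>a\<in>links P. Z a \<le> X a t)"

definition sp_feasible ::
  "'a design_problem \<Rightarrow> ('a \<Rightarrow> nat \<Rightarrow> real) \<Rightarrow> ('a \<times> 'a \<Rightarrow> nat \<Rightarrow> real) \<Rightarrow> 'a \<Rightarrow> nat \<Rightarrow> bool" where
  "sp_feasible P W X k t \<longleftrightarrow> (\<exists>Z. sp_feasible_point P W X k t Z)"

text \<open>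
  The dual linear program \<open>D\<^sub>k\<^sub>t(W, X)\<close>.  Vectors in \<open>\<real>\<^sup>N\<close> and \<open>\<real>\<^sup>A\<close> are functions of which
  only the values on \<open>nodes P\<close> and \<open>links P\<close> matter.
\<close>

definition dual_feasible ::
  "'a design_problem \<Rightarrow> 'a \<Rightarrow> nat \<Rightarrow> ('a \<Rightarrow> real) \<Rightarrow> ('a \<times> 'a \<Rightarrow> real) \<Rightarrow> bool" where
  "dual_feasible P k t \<gamma> l \<longleftrightarrow>
     (\<forall>i\<in>nodes P. 0 \<le> \<gamma> i) \<and>
     (\<forall>a\<in>links P. 0 \<le> l a) \<and>
     (\<forall>(i, j)\<in>links P. j \<noteq> k \<longrightarrow> route_cost P (i, j) t + l (i, j) + \<gamma> j - \<gamma> i \<ge> 0)"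

definition dual_objective ::
  "'a design_problem \<Rightarrow> ('a \<Rightarrow> nat \<Rightarrow> real) \<Rightarrow> ('a \<times> 'a \<Rightarrow> nat \<Rightarrow> real) \<Rightarrow>
     'a \<Rightarrow> nat \<Rightarrow> ('a \<Rightarrow> real) \<Rightarrow> ('a \<times> 'a \<Rightarrow> real) \<Rightarrow> real" where
  "dual_objective P W X k t \<gamma> l =
     \<gamma> k - (\<Sum>i\<in>nodes P. \<gamma> i * W i t) - (\<Sum>a\<in>links P. l a * X a t)"

definition dual_optimal ::
  "'a design_problem \<Rightarrow> ('a \<Rightarrow> nat \<Rightarrow> real) \<Rightarrow> ('a \<times> 'a \<Rightarrow> nat \<Rightarrow> real) \<Rightarrow>
     'a \<Rightarrow> nat \<Rightarrow> ('a \<Rightarrow> real) \<Rightarrow> ('a \<times> 'a \<Rightarrow> real) \<Rightarrow> bool" where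
  "dual_optimal P W X k t \<gamma> l \<longleftrightarrow>
     dual_feasible P k t \<gamma> l \<and>
     (\<forall>\<gamma>' l'. dual_feasible P k t \<gamma>' l' \<longrightarrow>
        dual_objective P W X k t \<gamma>' l' \<le> dual_objective P W X k t \<gamma> l)"

definition full_network :: "'a design_problem \<Rightarrow> ('a, 'a \<times> 'a) pre_digraph" where
  "full_network P = \<lparr>verts = nodes P, arcs = links P, tail = fst, head = snd\<rparr>"

definition open_network ::
  "'a design_problem \<Rightarrow> ('a \<times> 'a \<Rightarrow> nat \<Rightarrow> real) \<Rightarrow> nat \<Rightarrow> ('a, 'a \<times> 'a) pre_digraph" where
  "open_network P X t =
     \<lparr>verts = nodes P, arcs = {a \<in> links P. X a t = 1}, tail = fst, head = snd\<rparr>"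

text \<open>
  The equation for the shortest path length \<open>wf_digraph.\<mu>\<close> is only available for well-formed
  digraphs; both networks are well-formed.
\<close>

lemma wf_full_network: "valid_problem P \<Longrightarrow> wf_digraph (full_network P)"
  by unfold_locales (auto simp: valid_problem_def full_network_def)

lemma wf_open_network: "valid_problem P \<Longrightarrow> wf_digraph (open_network P X t)"
  by unfold_locales (auto simp: valid_problem_def open_network_def)

text \<open>
  \<open>facility_dist\<close> is the distance to the nearest open facility along open arcs (D-bar), and
  \<open>source_dist\<close> is the distance from \<open>k\<close> in the full network (D).  \<open>wf_digraph.\<mu>\<close> is the
  infimum of the costs of all walks, which is the length of a shortest path because the arc
  lengths are nonnegative.  An infimum over the empty set is \<open>\<infinity>\<close> in \<^typ>\<open>ereal\<close>, and the empty
  walk gives length 0 from a node to itself.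
\<close>

definition facility_dist ::
  "'a design_problem \<Rightarrow> ('a \<Rightarrow> nat \<Rightarrow> real) \<Rightarrow> ('a \<times> 'a \<Rightarrow> nat \<Rightarrow> real) \<Rightarrow> nat \<Rightarrow> 'a \<Rightarrow> ereal" where
  "facility_dist P W X t i =
     (INF j\<in>{j \<in> nodes P. W j t = 1}.
        wf_digraph.\<mu> (open_network P X t) (\<lambda>a. route_cost P a t) i j)"

definition source_dist :: "'a design_problem \<Rightarrow> 'a \<Rightarrow> nat \<Rightarrow> 'a \<Rightarrow> ereal" where
  "source_dist P k t i = wf_digraph.\<mu> (full_network P) (\<lambda>a. route_cost P a t) k i"

definition gamma_sol ::
  "'a design_problem \<Rightarrow> ('a \<Rightarrow> nat \<Rightarrow> real) \<Rightarrow> ('a \<times> 'a \<Rightarrow> nat \<Rightarrow> real) \<Rightarrow>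
     'a \<Rightarrow> nat \<Rightarrow> 'a \<Rightarrow> ereal" where
  "gamma_sol P W X k t i =
     (if i = k then facility_dist P W X t k
      else max 0 (min (facility_dist P W X t k - source_dist P k t i) (facility_dist P W X t i)))"

definition lambda_sol ::
  "'a design_problem \<Rightarrow> ('a \<times> 'a \<Rightarrow> nat \<Rightarrow> real) \<Rightarrow> nat \<Rightarrow> ('a \<Rightarrow> real) \<Rightarrow> 'a \<times> 'a \<Rightarrow> real" where
  "lambda_sol P X t \<gamma> = (\<lambda>(i, j).
     if X (i, j) t = 0 then max 0 (\<gamma> i - \<gamma> j - route_cost P (i, j) t) else 0)"

end

theory Submission
  imports Defs
begin

text \<open>
  Optimality follows from weak duality along a single path.  Open facilities have \<open>\<gamma> = 0\<close> and open
  arcs have \<open>\<lambda> = 0\<close>, so the proposed dual solution has objective value \<open>\<gamma>\<^sub>k\<close>, the cost of a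
  shortest path from \<open>k\<close> to an open facility in the open network.  Conversely, adding up the dual
  constraints along such a path bounds the objective of every dual feasible solution by this cost;
  as the path is simple, it does not enter \<open>k\<close> and uses every open arc at most once.
  Finiteness of \<open>\<gamma>\<^sub>k\<close> is a cut argument: if no open facility were reachable from \<open>k\<close>, then
  no flow could leave the set of nodes reachable from \<open>k\<close>.
\<close>

section \<open>Potentials and costs along walks\<close>

lemma (in wf_digraph) potential_diff_le_awalk_cost:
  fixes y :: "'a \<Rightarrow> real"
  assumes "awalk u p v" "\<And>a. a \<in> set p \<Longrightarrow> y (tail G a) - y (head G a) \<le> c a"
  shows "y u - y v \<le> awalk_cost c p"
  using assms
proof (induction p arbitrary: u)
  case Nil
  then show ?case by (simp add: awalk_Nil_iff)
next
  case (Cons a p)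
  have "y (head G a) - y v \<le> awalk_cost c p"
    using Cons by (simp add: awalk_Cons_iff)
  moreover have "y (tail G a) - y (head G a) \<le> c a"
    using Cons.prems by simp
  ultimately show ?case
    using Cons.prems(1) by (simp add: awalk_Cons_iff)
qed

text \<open>The heads of the arcs are the vertices after the start, and a simple path never repeats
  a vertex. Dual constraints exist only for arcs not entering \<open>k\<close>, so this makes them
  available on every arc of a simple path from \<open>k\<close>.\<close>

lemma (in wf_digraph) apath_head_neq_start:
  assumes "apath u p v" "a \<in> set p"
  shows "head G a \<noteq> u"
proof -
  obtain b q where "p = b # q" using assms(2) by (cases p) auto
  with assms(1) have "cas u (b # q) v" "distinct (awalk_verts u (b # q))"
    by (auto simp: apath_def awalk_def)
  then have "awalk_verts u p = u # map (head G) p" "distinct (awalk_verts u p)"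
    using awalk_verts_conv'[of u "b # q" v] \<open>p = b # q\<close> by auto
  then show ?thesis using assms(2) by auto
qed

lemma (in wf_digraph) awalk_cost_eq_sum:
  assumes "distinct p"
  shows "awalk_cost c p = sum c (set p)"
  using assms by (induction p) auto

section \<open>The two networks and the distances in them\<close>

lemma full_network_simps [simp]:
  "verts (full_network P) = nodes P" "arcs (full_network P) = links P"
  "tail (full_network P) = fst" "head (full_network P) = snd"
  by (simp_all add: full_network_def)

lemma open_network_simps [simp]:
  "verts (open_network P X t) = nodes P"
  "arcs (open_network P X t) = {a \<in> links P. X a t = 1}"
  "tail (open_network P X t) = fst" "head (open_network P X t) = snd"
  by (simp_all add: open_network_def)

lemma finite_links:
  assumes "valid_problem P"
  shows "finite (links P)"
  using assms finite_subset by (fastforce simp: valid_problem_def)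

lemma fin_digraph_full_network:
  assumes "valid_problem P"
  shows "fin_digraph (full_network P)"
proof -
  interpret wf_digraph "full_network P" using wf_full_network[OF assms] .
  show ?thesis
    using assms finite_links[OF assms]
    by unfold_locales (auto simp: valid_problem_def)
qed

lemma fin_digraph_open_network:
  assumes "valid_problem P"
  shows "fin_digraph (open_network P X t)"
proof -
  interpret wf_digraph "open_network P X t" using wf_open_network[OF assms] .
  show ?thesis
    using assms finite_links[OF assms]
    by unfold_locales (auto simp: valid_problem_def)
qed

lemma route_cost_nonneg:
  assumes "valid_problem P" "t \<in> periods P" "a \<in> links P"
  shows "0 \<le> route_cost P a t"
  using assms by (auto simp: valid_problem_def)

lemma source_dist_nonneg:
  assumes "valid_problem P" "t \<in> periods P"
  shows "0 \<le> source_dist P k t i"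
proof -
  interpret wf_digraph "full_network P" using wf_full_network[OF assms(1)] .
  show ?thesis
    unfolding source_dist_def \<mu>_def
    using route_cost_nonneg[OF assms]
    by (auto intro!: INF_greatest pos_cost_pos_awalk_cost)
qed

lemma source_dist_triangle:
  assumes "valid_problem P" "t \<in> periods P" "(i, j) \<in> links P"
  shows "source_dist P k t j \<le> source_dist P k t i + ereal (route_cost P (i, j) t)"
proof -
  interpret fin_digraph "full_network P" using fin_digraph_full_network[OF assms(1)] .
  show ?thesis
    unfolding source_dist_def using assms route_cost_nonneg
    by (intro pos_cost_mu_triangle) (auto simp: arc_to_ends_def)
qed

lemma source_dist_self_le:
  assumes "valid_problem P" "k \<in> nodes P"
  shows "source_dist P k t k \<le> 0"
proof -
  interpret wf_digraph "full_network P" using wf_full_network[OF assms(1)] .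
  have "awalk k [] k" using assms by (simp add: awalk_Nil_iff)
  from min_cost_le_walk_cost[OF this] show ?thesis
    by (simp add: source_dist_def zero_ereal_def)
qed

lemma facility_dist_le_awalk_cost:
  assumes "valid_problem P" "pre_digraph.awalk (open_network P X t) i p j" "W j t = 1"
  shows "facility_dist P W X t i \<le> ereal (wf_digraph.awalk_cost (\<lambda>a. route_cost P a t) p)"
proof -
  interpret wf_digraph "open_network P X t" using wf_open_network[OF assms(1)] .
  have "j \<in> nodes P" using awalk_last_in_verts[OF assms(2)] by simp
  then show ?thesis
    unfolding facility_dist_def
    using assms(3) min_cost_le_walk_cost[OF assms(2)] by (intro INF_lower2) auto
qed

text \<open>The infimum ranges over finitely many facilities, so one of them attains it. Nonnegative
  costs in a finite digraph then yield a cheapest walk that is simple.\<close>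

lemma facility_dist_attained:
  assumes "valid_problem P" "t \<in> periods P" "facility_dist P W X t i \<noteq> \<infinity>"
  obtains p j where "pre_digraph.apath (open_network P X t) i p j" "W j t = 1"
    "facility_dist P W X t i = ereal (wf_digraph.awalk_cost (\<lambda>a. route_cost P a t) p)"
proof -
  interpret fin_digraph "open_network P X t" using fin_digraph_open_network[OF assms(1)] .
  let ?c = "\<lambda>a. route_cost P a t"
  let ?S = "{j \<in> nodes P. W j t = 1}"
  have "finite ?S" using assms(1) by (simp add: valid_problem_def)
  \<comment> \<open>With no open facility the infimum would be over the empty set, hence
    infinite.\<close>
  moreover have "?S \<noteq> {}"
  proof
    assume "?S = {}"
    then have "facility_dist P W X t i = \<infinity>"
      unfolding facility_dist_def by (simp only: image_empty Inf_empty top_ereal_def)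
    with assms(3) show False by simp
  qed
  ultimately have "facility_dist P W X t i \<in> (\<lambda>j. \<mu> ?c i j) ` ?S"
    unfolding facility_dist_def by (rule finite_INF_in)
  then obtain j where j: "j \<in> ?S" "facility_dist P W X t i = \<mu> ?c i j" by auto
  \<comment> \<open>An unreachable \<open>j\<close> would have infinite distance.\<close>
  with assms(3) have "i \<rightarrow>\<^sup>*\<^bsub>open_network P X t\<^esub> j" using shortest_path_inf by metis
  then obtain p where "apath i p j" "\<mu> ?c i j = awalk_cost ?c p"
    using min_cost_awalk[of i j ?c] route_cost_nonneg[OF assms(1,2)]
    by auto
  with j that show thesis by simp
qed

lemma facility_dist_nonneg:
  assumes "valid_problem P" "t \<in> periods P"
  shows "0 \<le> facility_dist P W X t i"
proof -
  interpret wf_digraph "open_network P X t" using wf_open_network[OF assms(1)] .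
  show ?thesis
    unfolding facility_dist_def \<mu>_def
    using route_cost_nonneg[OF assms]
    by (auto intro!: INF_greatest pos_cost_pos_awalk_cost)
qed

lemma facility_dist_open_facility:
  assumes "valid_problem P" "t \<in> periods P" "i \<in> nodes P" "W i t = 1"
  shows "facility_dist P W X t i = 0"
proof -
  interpret wf_digraph "open_network P X t" using wf_open_network[OF assms(1)] .
  have "awalk i [] i" using assms by (simp add: awalk_Nil_iff)
  from facility_dist_le_awalk_cost[OF assms(1) this, of W] assms(4)
  have "facility_dist P W X t i \<le> 0" by (simp add: zero_ereal_def)
  then show ?thesis using facility_dist_nonneg[OF assms(1,2)] by (rule antisym)
qed

lemma facility_dist_triangle:
  assumes "valid_problem P" "t \<in> periods P" "(i, j) \<in> links P" "X (i, j) t = 1"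
  shows "facility_dist P W X t i \<le> ereal (route_cost P (i, j) t) + facility_dist P W X t j"
proof (cases "facility_dist P W X t j = \<infinity>")
  case False
  interpret wf_digraph "open_network P X t" using wf_open_network[OF assms(1)] .
  obtain p f where p: "apath j p f" "W f t = 1"
    "facility_dist P W X t j = ereal (awalk_cost (\<lambda>a. route_cost P a t) p)"
    using facility_dist_attained[OF assms(1,2) False] .
  \<comment> \<open>Prepending the arc may destroy simplicity, but any walk bounds the
    distance.\<close>
  have "awalk i ((i, j) # p) f"
    using p(1) assms(3,4) by (simp add: awalk_Cons_iff awalkI_apath)
  from facility_dist_le_awalk_cost[OF assms(1) this, of W, OF p(2)] p(3) show ?thesis by simp
qed simp

section \<open>Flow balance over a node set, and finiteness of \<open>facility_dist\<close> at
  \<open>k\<close>\<close>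

lemma sum_fst_eq:
  fixes f :: "'a \<times> 'a \<Rightarrow> real"
  assumes "finite S" "finite A"
  shows "(\<Sum>i\<in>S. \<Sum>j | (i, j) \<in> A. f (i, j)) = (\<Sum>a | a \<in> A \<and> fst a \<in> S. f a)"
proof -
  have fin: "finite {j. (i, j) \<in> A}" for i
    by (rule finite_subset[of _ "snd ` A"]) (use assms in force)+
  have "(\<Sum>i\<in>S. \<Sum>j | (i, j) \<in> A. f (i, j)) = sum f (SIGMA i:S. {j. (i, j) \<in> A})"
    using assms fin by (simp add: sum.Sigma)
  also have "(SIGMA i:S. {j. (i, j) \<in> A}) = {a. a \<in> A \<and> fst a \<in> S}" by auto
  finally show ?thesis .
qed

text \<open>This is the tail version applied to the converse relation.\<close>

lemma sum_snd_eq: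
  fixes f :: "'a \<times> 'a \<Rightarrow> real"
  assumes "finite S" "finite A"
  shows "(\<Sum>i\<in>S. \<Sum>j | (j, i) \<in> A. f (j, i)) = (\<Sum>a | a \<in> A \<and> snd a \<in> S. f a)"
proof -
  have "(\<Sum>i\<in>S. \<Sum>j | (j, i) \<in> A. f (j, i)) = (\<Sum>a | a \<in> A\<inverse> \<and> fst a \<in> S. f (prod.swap a))"
    using sum_fst_eq[of S "A\<inverse>" "f \<circ> prod.swap"] assms by simp
  also have "\<dots> = (\<Sum>a | a \<in> A \<and> snd a \<in> S. f a)"
    by (rule sum.reindex_bij_witness[of _ prod.swap prod.swap]) auto
  finally show ?thesis .
qed

text \<open>If the distance were infinite, the balances inflow minus outflow, summed over the nodes
  reachable from \<open>k\<close>, would be nonnegative by the cut argument but at most -1 by the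
  flow constraints.\<close>

lemma facility_dist_finite:
  assumes "valid_problem P" "(W, X, U, V) \<in> master_solutions P"
    and "k \<in> nodes P" "t \<in> periods P" "sp_feasible P W X k t"
  shows "facility_dist P W X t k \<noteq> \<infinity>"
proof
  assume inf: "facility_dist P W X t k = \<infinity>"
  interpret wf_digraph "open_network P X t" using wf_open_network[OF assms(1)] .
  obtain Z where Z: "sp_feasible_point P W X k t Z"
    using assms(5) by (auto simp: sp_feasible_def)
  define S where "S = {i. k \<rightarrow>\<^sup>*\<^bsub>open_network P X t\<^esub> i}"
  have S_nodes: "S \<subseteq> nodes P"
    unfolding S_def by (auto elim!: reachable_in_vertsE)
  have fin: "finite S" "finite (links P)"
    using S_nodes assms(1) finite_links finite_subset by (auto simp: valid_problem_def)
  have kS: "k \<in> S" using assms(3) by (simp add: S_def)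
  have W0: "W i t = 0" if i: "i \<in> S" for i
  proof (rule ccontr)
    assume "W i t \<noteq> 0"
    then have "W i t = 1"
      using i S_nodes assms(2,4) by (auto simp: master_solutions_def)
    moreover obtain p where "awalk k p i"
      using i unfolding S_def reachable_awalk by blast
    ultimately show False
      using facility_dist_le_awalk_cost[OF assms(1), of X t k p i W] inf by simp
  qed
  \<comment> \<open>Flow is bounded by \<open>X\<close>, so an arc carrying flow is open and keeps
    its head reachable.\<close>
  have out: "snd a \<in> S" if a: "a \<in> links P" "fst a \<in> S" "Z a \<noteq> 0" for a
  proof -
    obtain i j where [simp]: "a = (i, j)" by fastforce
    have "0 \<le> Z a" "Z a \<le> X a t" using Z a(1) by (simp_all add: sp_feasible_point_def)
    then have "X a t \<noteq> 0" using a(3) by linarith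
    then have "X a t = 1" using a(1) assms(2,4) by (auto simp: master_solutions_def)
    then have "arc a (i, j)" using a by (simp add: arc_def)
    with a(2) show ?thesis
      using reachable_arc_trans[of k i a j] by (simp add: S_def)
  qed
  let ?in = "\<lambda>i. \<Sum>j | (j, i) \<in> links P. Z (j, i)"
  let ?out = "\<lambda>i. \<Sum>j | (i, j) \<in> links P. Z (i, j)"
  have "(\<Sum>i\<in>S. ?out i) = (\<Sum>a | a \<in> links P \<and> fst a \<in> S. Z a)"
    using fin by (rule sum_fst_eq)
  also have "\<dots> = (\<Sum>a | a \<in> links P \<and> fst a \<in> S \<and> snd a \<in> S. Z a)"
    using fin out by (intro sum.mono_neutral_right) auto
  also have "\<dots> \<le> (\<Sum>a | a \<in> links P \<and> snd a \<in> S. Z a)"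
    using fin Z by (intro sum_mono2) (auto simp: sp_feasible_point_def)
  also have "\<dots> = (\<Sum>i\<in>S. ?in i)"
    using fin by (rule sum_snd_eq[symmetric])
  finally have "0 \<le> (\<Sum>i\<in>S. ?in i - ?out i)" by (simp add: sum_subtractf)
  also have "\<dots> = (?in k - ?out k) + (\<Sum>i\<in>S - {k}. ?in i - ?out i)"
    using fin kS by (simp add: sum.remove)
  also have "(\<Sum>i\<in>S - {k}. ?in i - ?out i) \<le> 0"
  proof (rule sum_nonpos)
    fix i assume "i \<in> S - {k}"
    with S_nodes W0 have "i \<in> nodes P - {k}" "W i t = 0" by auto
    with Z show "?in i - ?out i \<le> 0" unfolding sp_feasible_point_def by metis
  qed
  also have "?in k = 0"
    using Z by (intro sum.neutral) (auto simp: sp_feasible_point_def)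
  \<comment> \<open>Only the outflow of \<open>k\<close> remains, and it is at least 1 because
    \<open>W k t = 0\<close>.\<close>
  finally show False
    using Z W0[OF kS] by (simp add: sp_feasible_point_def)
qed

section \<open>The proposed dual values\<close>

lemma gamma_sol_self: "gamma_sol P W X k t k = facility_dist P W X t k"
  by (simp add: gamma_sol_def)

lemma gamma_sol_nonneg:
  assumes "valid_problem P" "t \<in> periods P"
  shows "0 \<le> gamma_sol P W X k t i"
  using facility_dist_nonneg[OF assms] by (simp add: gamma_sol_def)

text \<open>Both distances of \<open>i\<close> may be infinite, but \<open>source_dist\<close> is
  nonnegative, so the value is capped by the one at \<open>k\<close>.\<close>

lemma gamma_sol_finite:
  assumes "valid_problem P" "t \<in> periods P" "facility_dist P W X t k \<noteq> \<infinity>"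
  shows "\<bar>gamma_sol P W X k t i\<bar> \<noteq> \<infinity>"
proof -
  have "gamma_sol P W X k t i \<le> facility_dist P W X t k"
    using facility_dist_nonneg[OF assms(1,2), of W X k] source_dist_nonneg[OF assms(1,2), of k i]
    by (cases "facility_dist P W X t k"; cases "source_dist P k t i")
      (auto simp: gamma_sol_def min_le_iff_disj)
  then show ?thesis
    using gamma_sol_nonneg[OF assms(1,2), of W X k i] assms(3) by auto
qed

lemma gamma_sol_open_facility:
  assumes "valid_problem P" "t \<in> periods P" "i \<in> nodes P" "W i t = 1"
  shows "gamma_sol P W X k t i = 0"
  using facility_dist_open_facility[of P t i W X, OF assms]
  by (auto simp: gamma_sol_def min_def max_def)

text \<open>This is the dual constraint on an open arc, where \<lambda> vanishes. Both arguments of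
  the minimum obey the triangle inequality, and truncation at 0 keeps it because the arc length is
  nonnegative.\<close>

lemma gamma_sol_open_link:
  assumes "valid_problem P" "k \<in> nodes P" "t \<in> periods P"
    and "(i, j) \<in> links P" "X (i, j) t = 1" "j \<noteq> k"
    and "facility_dist P W X t k \<noteq> \<infinity>"
  shows "gamma_sol P W X k t i \<le> ereal (route_cost P (i, j) t) + gamma_sol P W X k t j"
proof -
  let ?r = "route_cost P (i, j) t"
  let ?F = "facility_dist P W X t" and ?D = "source_dist P k t"
  have r: "0 \<le> ereal ?r" using route_cost_nonneg[OF assms(1,3,4)] by simp
  have F: "?F i \<le> ereal ?r + ?F j" by (rule facility_dist_triangle) (use assms in auto)
  have D: "?D j \<le> ?D i + ereal ?r" by (rule source_dist_triangle) (use assms in auto)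
  obtain f where f: "?F k = ereal f"
    using assms(7) facility_dist_nonneg[OF assms(1,3), of W X k] by (cases "?F k") auto
  \<comment> \<open>As \<open>?F k\<close> is finite, an infinite \<open>?D i\<close> makes the left
    side minus infinity; an infinite \<open>?D j\<close> forces \<open>?D i\<close> to be infinite
    by \<open>D\<close>.\<close>
  have FD: "?F k - ?D i \<le> ereal ?r + (?F k - ?D j)"
    using D f source_dist_nonneg[OF assms(1,3), of k] by (cases "?D i"; cases "?D j") auto
  have "min (?F k - ?D i) (?F i) \<le> ereal ?r + min (?F k - ?D j) (?F j)"
    using F FD by (auto simp: min_def intro: order_trans)
  also have "\<dots> \<le> ereal ?r + gamma_sol P W X k t j"
    using assms(6) by (simp add: gamma_sol_def add_left_mono)
  finally have *: "min (?F k - ?D i) (?F i) \<le> ereal ?r + gamma_sol P W X k t j" .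
  show ?thesis
  proof (cases "i = k")
    case True
    \<comment> \<open>Hence at \<open>k\<close> the minimum equals \<open>?F k\<close>, in agreement
      with the separate definition of the value there.\<close>
    have "?D k = 0"
      using source_dist_self_le[OF assms(1,2)] source_dist_nonneg[OF assms(1,3)] by (rule antisym)
    with True * show ?thesis by (simp add: gamma_sol_self)
  next
    case False
    have "0 \<le> ereal ?r + gamma_sol P W X k t j"
      using r gamma_sol_nonneg[OF assms(1,3)] by (rule add_nonneg_nonneg)
    with False * show ?thesis by (simp add: gamma_sol_def[of P W X k t i])
  qed
qed

section \<open>Weak duality along a path, and optimality\<close>

lemma dual_objective_le_facility_dist:
  assumes "valid_problem P" "(W, X, U, V) \<in> master_solutions P" "t \<in> periods P"
    and "dual_feasible P k t y l"
  shows "ereal (dual_objective P W X k t y l) \<le> facility_dist P W X t k"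
proof (cases "facility_dist P W X t k = \<infinity>")
  case False
  interpret wf_digraph "open_network P X t" using wf_open_network[OF assms(1)] .
  let ?c = "\<lambda>a. route_cost P a t"
  obtain p f where p: "apath k p f" "W f t = 1" "facility_dist P W X t k = ereal (awalk_cost ?c p)"
    using facility_dist_attained[OF assms(1,3) False] .
  have aw: "awalk k p f" using p(1) by (rule awalkI_apath)
  have f: "f \<in> nodes P" using awalk_last_in_verts[OF aw] by simp
  have ps: "set p \<subseteq> {a \<in> links P. X a t = 1}"
    using aw by (simp add: awalk_def)
  have dist: "distinct p"
    using p(1) by (auto simp: apath_def intro: distinct_verts_imp_distinct)
  have "\<forall>a\<in>links P. X a t \<in> {0, 1}" "\<forall>i\<in>nodes P. W i t \<in> {0, 1}"
    using assms(2,3) by (simp_all add: master_solutions_def)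
  then have XW: "\<forall>a\<in>links P. 0 \<le> X a t" "\<forall>i\<in>nodes P. 0 \<le> W i t"
    by fastforce+
  have yl: "\<forall>a\<in>links P. 0 \<le> l a" "\<forall>i\<in>nodes P. 0 \<le> y i"
    using assms(4) by (simp_all add: dual_feasible_def)
  \<comment> \<open>The dual constraints make \<open>y\<close> a potential for the arc costs raised
    by \<open>l\<close>.\<close>
  have "y k - y f \<le> awalk_cost (\<lambda>a. ?c a + l a) p"
  proof (rule potential_diff_le_awalk_cost[OF aw])
    fix a assume a: "a \<in> set p"
    obtain i j where [simp]: "a = (i, j)" by fastforce
    have "j \<noteq> k" using apath_head_neq_start[OF p(1) a] by simp
    moreover have "(i, j) \<in> links P" using ps a by auto
    ultimately have "0 \<le> ?c (i, j) + l (i, j) + y j - y i"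
      using assms(4) by (auto simp: dual_feasible_def)
    then show "y (tail (open_network P X t) a) - y (head (open_network P X t) a) \<le> ?c a + l a"
      by simp
  qed
  also have "\<dots> = awalk_cost ?c p + (\<Sum>a\<in>set p. l a)"
    using dist by (simp add: awalk_cost_eq_sum sum.distrib)
  \<comment> \<open>All arcs of the path are open; the remaining arcs then contribute nonnegative
    terms.\<close>
  also have "(\<Sum>a\<in>set p. l a) = (\<Sum>a\<in>set p. l a * X a t)"
    using ps by (intro sum.cong) auto
  also have "\<dots> \<le> (\<Sum>a\<in>links P. l a * X a t)"
    using ps XW yl finite_links[OF assms(1)] by (intro sum_mono2) auto
  finally have "y k - y f \<le> awalk_cost ?c p + (\<Sum>a\<in>links P. l a * X a t)" by simp
  \<comment> \<open>The facility term of the objective pays for the potential \<open>y f\<close> at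
    the end of the path, since \<open>W f t = 1\<close>.\<close>
  moreover have "y f * W f t \<le> (\<Sum>i\<in>nodes P. y i * W i t)"
    using f XW yl assms(1) by (intro member_le_sum) (auto simp: valid_problem_def)
  ultimately show ?thesis
    using p(2,3) by (simp add: dual_objective_def)
qed simp

theorem theorem2:
  fixes P :: "'a design_problem"
    and W U :: "'a \<Rightarrow> nat \<Rightarrow> real"
    and X V :: "'a \<times> 'a \<Rightarrow> nat \<Rightarrow> real"
    and k :: 'a and t :: nat
  assumes "valid_problem P"
    and "(W, X, U, V) \<in> master_solutions P"
    and "k \<in> nodes P"
    and "t \<in> periods P"
    and "sp_feasible P W X k t"
  shows "(\<forall>i\<in>nodes P. \<bar>gamma_sol P W X k t i\<bar> \<noteq> \<infinity>) \<and>
    (let \<gamma> = (\<lambda>i. real_of_ereal (gamma_sol P W X k t i))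
     in dual_optimal P W X k t \<gamma> (lambda_sol P X t \<gamma>))"
proof -
  define y where "y = (\<lambda>i. real_of_ereal (gamma_sol P W X k t i))"
  define l where "l = lambda_sol P X t y"
  have finite_k: "facility_dist P W X t k \<noteq> \<infinity>"
    using assms by (rule facility_dist_finite)
  have gamma_finite: "\<bar>gamma_sol P W X k t i\<bar> \<noteq> \<infinity>" for i
    using assms(1,4) finite_k by (rule gamma_sol_finite)
  have gamma_eq: "gamma_sol P W X k t i = ereal (y i)" for i
    using gamma_finite[of i] by (simp add: y_def ereal_real)
  have X01: "X a t = 0 \<or> X a t = 1" if "a \<in> links P" for a
    using that assms(2,4) by (auto simp: master_solutions_def)
  have W01: "W i t = 0 \<or> W i t = 1" if "i \<in> nodes P" for i
    using that assms(2,4) by (auto simp: master_solutions_def)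
  have "dual_feasible P k t y l"
    unfolding dual_feasible_def
  proof (intro conjI ballI)
    show "0 \<le> y i" for i
      using gamma_sol_nonneg[OF assms(1,4)] by (simp add: y_def real_of_ereal_pos)
    show "0 \<le> l a" for a
      by (simp add: l_def lambda_sol_def split: prod.split)
  next
    fix a assume a: "a \<in> links P"
    obtain i j where [simp]: "a = (i, j)" by fastforce
    have "y i \<le> route_cost P (i, j) t + y j" if "X (i, j) t = 1" "j \<noteq> k"
      using gamma_sol_open_link[of P k t i j X W] that a assms finite_k by (simp add: gamma_eq)
    \<comment> \<open>On a closed arc \<open>l\<close> is at least the amount by which the
      constraint would fail with \<open>l\<close> set to 0.\<close>
    then show "case a of (i, j) \<Rightarrow> j \<noteq> k \<longrightarrow> 0 \<le> route_cost P (i, j) t + l (i, j) + y j - y i"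
      using X01[OF a] by (auto simp: l_def lambda_sol_def)
  qed
  moreover have "ereal (dual_objective P W X k t y l) = facility_dist P W X t k"
  proof -
    \<comment> \<open>In both sums every term has a vanishing factor, which leaves only
      \<open>y k\<close>.\<close>
    have "(\<Sum>i\<in>nodes P. y i * W i t) = 0"
      using W01 gamma_sol_open_facility[OF assms(1,4)] by (intro sum.neutral) (fastforce simp: y_def)
    moreover have "(\<Sum>a\<in>links P. l a * X a t) = 0"
      using X01 by (intro sum.neutral) (force simp: l_def lambda_sol_def)
    ultimately show ?thesis
      by (simp add: dual_objective_def flip: gamma_eq gamma_sol_self[of P W X k t])
  qed
  \<comment> \<open>The objective attains the upper bound valid for all dual feasible
    solutions.\<close>
  ultimately have "dual_optimal P W X k t y l"
    unfolding dual_optimal_def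
    using dual_objective_le_facility_dist[OF assms(1,2,4)] ereal_less_eq(3) by metis
  then show ?thesis
    using gamma_finite by (simp add: l_def y_def Let_def)
qed

end
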